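(* Fix $t$, $\delta\in(0,1)$ and $\Lambda>2$. Let $(\hat\lambda,\hat b_{t+1})\in\arg\min_{\lambda\in(2,\Lambda),\,b\in H}\hat J_t(\lambda,b)$ be empirical risk minimizers of $\hat J_t$, and let $\hat B_{t+1}(x_{t+1}):=\hat b_{t+1}(x_{t+1})+\hat\tau_{\hat\lambda,\hat b_{t+1}}+\epsilon_0$ be the associated Learnable Chernoff Baseline. Assume that $\hat B_{t+1}$ has worst-case coverage at level $c\in(0,1)$, i.e. $\Pr_{x_t\sim p^{\mathrm{pre}}_t(\cdot\mid x_{t+1})}[\hat v_t(x_t)\ge \hat B_{t+1}(x_{t+1})]\le c$ for all $x_{t+1}$. Then, on the good training event $\mathcal G_t$, the kernel $\hat q_t(\cdot\mid x_{t+1})$ induced by rejection sampling with baseline $\hat B_{t+1}$ satisfies $$\mathbb E_{x_{t+1}\sim\hat q_{t+1}}\left[d_{TV}\left(\hat q_t(\cdot\mid x_{t+1}),\hat p_t(\cdot\mid x_{t+1})\right)\right]\le \frac{2\delta}{(1-c)^2}\,e^{J^*_t+2\epsilon_0}.$$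
   Context: $\mathcal X$ is a (continuous or discrete) state space; the pretrained Markov process has initial law $p^{\mathrm{pre}}_T$ and kernels $p^{\mathrm{pre}}_t(x_t\mid x_{t+1})$, $t=0,\dots,T-1$. $\hat v_t:\mathcal X\to[-B,B]$ are given estimates of soft-value functions, and $\hat p_t(x_t\mid x_{t+1})\propto e^{\hat v_t(x_t)}p^{\mathrm{pre}}_t(x_t\mid x_{t+1})$. Sampling with baselines: given a baseline function $B_{t+1}:\mathcal X\to\mathbb R$, $\hat q_t(\cdot\mid x_{t+1})$ is the law of the first accepted proposal when i.i.d. proposals $x_t\sim p^{\mathrm{pre}}_t(\cdot\mid x_{t+1})$ are each accepted with probability $\min\{1,e^{\hat v_t(x_t)-B_{t+1}(x_{t+1})}\}$. $\hat q_{t+1}$ denotes the marginal law of $x_{t+1}$ produced by this sampler at the earlier steps $T,\dots,t+1$ (started by accepting proposals from $p^{\mathrm{pre}}_T$ with probability $\min\{1,e^{\hat v_T(x_T)-B_{T+1}}\}$ for a constant $B_{T+1}$). Let $H$ be a class of functions $\mathcal X\to[-B,B]$. With $\mathbb E$ the expectation over $x_{t+1}\sim\hat q_{t+1}$, $x_t\sim p^{\mathrm{pre}}_t(\cdot\mid x_{t+1})$, define $$J_t(\lambda,b)=\tfrac1\lambda\log\mathbb E[e^{\lambda(\hat v_t(x_t)-b(x_{t+1}))}]+\tfrac1\lambda\log\mathbb E[e^{\lambda(b(x_{t+1})-\hat v_t(x_t))}]+\tfrac2\lambda\log\tfrac1\delta,$$ $$\tau_{\lambda,b}=\tfrac1\lambda\left(\log\tfrac1\delta+\log\mathbb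 E[e^{\lambda(\hat v_t(x_t)-b(x_{t+1}))}]\right).$$ $\hat J_t$ and $\hat\tau_{\lambda,b}$ are obtained by replacing $\mathbb E$ by the empirical average $\hat{\mathbb E}$ over $m$ i.i.d. samples $(x^i_{t+1},x^i_t)$ from this joint law. $J_t^*$ is the minimum of $J_t$ over $(2,\Lambda)\times H$ (assumed attained). For $\eta\in(0,1)$, $\epsilon_0:=e^{4B\Lambda}\left(2\hat{\mathcal R}_m(H)+\sqrt{\log(1/\eta)/(2m)}\right)$, where $\hat{\mathcal R}_m(H)=\mathbb E_\sigma[\sup_{b\in H}\frac1m\sum_i\sigma_i b(x^i_{t+1})]$ ($\sigma_i$ i.i.d. Rademacher) is the empirical Rademacher complexity. The good training event $\mathcal G_t$ is the event (over the $m$ training samples) that $J_t(\hat\lambda,\hat b_{t+1})-J^*_t\le2\epsilon_0$ and $|\hat\tau_{\hat\lambda,\hat b_{t+1}}-\tau_{\hat\lambda,\hat b_{t+1}}|\le\epsilon_0$. $d_{TV}$ is total variation distance. *)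

theory Defs
  imports "HOL-Probability.Probability"
begin

definition tv_dist :: "'a measure \<Rightarrow> 'a measure \<Rightarrow> real" where
  "tv_dist M N = (SUP A\<in>sets M. \<bar>measure M A - measure N A\<bar>)"

definition reweight :: "'a measure \<Rightarrow> ('a \<Rightarrow> real) \<Rightarrow> 'a measure" where
  "reweight p w = density p (\<lambda>x. ennreal (w x / (\<integral>z. w z \<partial>p)))"

(* The n-th proposal fst (s n) is accepted iff the independent uniform variable snd (s n)
   is at most acc (fst (s n)), i.e. with probability acc (fst (s n)) when acc takes values
   in [0,1].  If acc is positive, some proposal is accepted almost surely; the value of LEAST
   on the remaining null set does not affect the law. *)
definition rejection_law :: "'a measure \<Rightarrow> ('a \<Rightarrow> real) \<Rightarrow> 'a measure" where
  "rejection_law p acc =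
     distr (\<Pi>\<^sub>M n\<in>(UNIV :: nat set). p \<Otimes>\<^sub>M uniform_measure lborel {0..1::real}) p
       (\<lambda>s. fst (s (LEAST n. snd (s n) \<le> acc (fst (s n)))))"

(* One step of the sampler, with value function f and baseline value \<beta>. *)
definition baseline_step :: "'a measure \<Rightarrow> ('a \<Rightarrow> real) \<Rightarrow> real \<Rightarrow> 'a measure" where
  "baseline_step p f \<beta> = rejection_law p (\<lambda>x. min 1 (exp (f x - \<beta>)))"

(* sampler_after ... k is the law of the state after the initial step and k further steps,
   i.e. of the state with time index T - k (time runs downwards from T).  The step that
   produces x_s from x_(s+1) uses the kernel pre s, the value function v s and the baseline
   base (s + 1) evaluated at x_(s+1). *)
primrec sampler_after ::
  "nat \<Rightarrow> 'a measure \<Rightarrow> (nat \<Rightarrow> 'a \<Rightarrow> 'a measure) \<Rightarrow> (nat \<Rightarrow> 'a \<Rightarrow> real) \<Rightarrow> real \<Rightarrow>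
   (nat \<Rightarrow> 'a \<Rightarrow> real) \<Rightarrow> nat \<Rightarrow> 'a measure" where
  "sampler_after T pre_init pre v base_init base 0 = baseline_step pre_init (v T) base_init"
| "sampler_after T pre_init pre v base_init base (Suc k) =
     sampler_after T pre_init pre v base_init base k \<bind>
       (\<lambda>y. baseline_step (pre (T - Suc k) y) (v (T - Suc k)) (base (T - k) y))"

definition sampler_marginal ::
  "nat \<Rightarrow> 'a measure \<Rightarrow> (nat \<Rightarrow> 'a \<Rightarrow> 'a measure) \<Rightarrow> (nat \<Rightarrow> 'a \<Rightarrow> real) \<Rightarrow> real \<Rightarrow>
   (nat \<Rightarrow> 'a \<Rightarrow> real) \<Rightarrow> nat \<Rightarrow> 'a measure" where
  "sampler_marginal T pre_init pre v base_init base s =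
     sampler_after T pre_init pre v base_init base (T - s)"

definition joint_law :: "'a measure \<Rightarrow> 'a measure \<Rightarrow> ('a \<Rightarrow> 'a measure) \<Rightarrow> ('a \<times> 'a) measure" where
  "joint_law X q K = q \<bind> (\<lambda>y. distr (K y) (X \<Otimes>\<^sub>M X) (\<lambda>x. (y, x)))"

(* The objective and the threshold are parametrised by the expectation operator E on functions
   of the pair (x_(t+1), x_t), so that the population and the empirical versions differ only
   in E; f is the value function at time t. *)
definition chernoff_objective ::
  "(('a \<times> 'a \<Rightarrow> real) \<Rightarrow> real) \<Rightarrow> ('a \<Rightarrow> real) \<Rightarrow> real \<Rightarrow> real \<Rightarrow> ('a \<Rightarrow> real) \<Rightarrow> real" where
  "chernoff_objective E f \<delta> l b =
     1 / l * ln (E (\<lambda>(y, x). exp (l * (f x - b y)))) +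
     1 / l * ln (E (\<lambda>(y, x). exp (l * (b y - f x)))) +
     2 / l * ln (1 / \<delta>)"

definition chernoff_threshold ::
  "(('a \<times> 'a \<Rightarrow> real) \<Rightarrow> real) \<Rightarrow> ('a \<Rightarrow> real) \<Rightarrow> real \<Rightarrow> real \<Rightarrow> ('a \<Rightarrow> real) \<Rightarrow> real" where
  "chernoff_threshold E f \<delta> l b =
     1 / l * (ln (1 / \<delta>) + ln (E (\<lambda>(y, x). exp (l * (f x - b y)))))"

definition empirical_mean :: "nat \<Rightarrow> (nat \<Rightarrow> 'b) \<Rightarrow> ('b \<Rightarrow> real) \<Rightarrow> real" where
  "empirical_mean m \<omega> g = (\<Sum>i<m. g (\<omega> i)) / real m"

definition empirical_rademacher :: "nat \<Rightarrow> ('a \<Rightarrow> real) set \<Rightarrow> (nat \<Rightarrow> 'a) \<Rightarrow> real" where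
  "empirical_rademacher m H z =
     measure_pmf.expectation (Pi_pmf {..<m} 0 (\<lambda>_. pmf_of_set {-1, 1}))
       (\<lambda>\<sigma>. SUP b\<in>H. 1 / real m * (\<Sum>i<m. \<sigma> i * b (z i)))"

end

theory Submission
  imports Defs
begin

text \<open>
  By a geometric series, the rejection sampler with acceptance probability \<open>min 1 (exp (f - \<beta>))\<close>
  has the law obtained by reweighting the proposal, and its total variation distance from the
  \<open>exp f\<close>-tilted proposal is at most \<open>E max 0 (exp f - exp \<beta>) / E exp f\<close>. This bound decreases
  in \<open>\<beta>\<close>, so on the good event \<open>\<beta>\<close> may be replaced by \<open>b + \<tau>\<close>. With \<open>s = f - b - \<tau>\<close> and any
  \<open>k\<close>, distinguishing whether \<open>E exp s \<ge> exp (- k)\<close> gives the conditional bound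
  \<open>E (exp k * exp (\<lambda> s) + exp (- \<lambda> (k + s)))\<close>. For \<open>k = J(\<lambda>, b)\<close> the definitions of \<open>\<tau>\<close> and
  \<open>J\<close> are such that averaging over the earlier state yields exactly \<open>\<delta> (exp k + 1)\<close>, and
  \<open>J \<ge> 0\<close> bounds this by \<open>2 \<delta> exp J\<close>.
\<close>

section \<open>Probabilities under a reweighted measure\<close>

lemma
  assumes p: "prob_space p" and w[measurable]: "w \<in> borel_measurable p"
    and nonneg: "\<And>x. x \<in> space p \<Longrightarrow> 0 \<le> w x" and int: "integrable p w"
    and pos: "0 < (\<integral>x. w x \<partial>p)"
  shows measure_reweight: "A \<in> sets p \<Longrightarrow>
      measure (reweight p w) A = (\<integral>x. indicator A x * w x \<partial>p) / (\<integral>x. w x \<partial>p)"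
    and prob_space_reweight: "prob_space (reweight p w)"
proof -
  let ?W = "\<integral>x. w x \<partial>p"
  have em: "emeasure (reweight p w) A = ennreal ((\<integral>x. indicator A x * w x \<partial>p) / ?W)"
    if [measurable]: "A \<in> sets p" for A
  proof -
    have "emeasure (reweight p w) A = (\<integral>\<^sup>+x. ennreal (indicator A x * w x / ?W) \<partial>p)"
      unfolding reweight_def
      by (subst emeasure_density) (auto intro!: nn_integral_cong simp: indicator_def)
    also have "\<dots> = ennreal (\<integral>x. indicator A x * w x / ?W \<partial>p)"
      using nonneg pos integrable_mult_indicator[OF that int]
      by (intro nn_integral_eq_integral) auto
    finally show ?thesis by simp
  qed
  show "measure (reweight p w) A = (\<integral>x. indicator A x * w x \<partial>p) / ?W" if "A \<in> sets p" for A
    unfolding measure_def em[OF that] using pos nonneg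
    by (intro enn2real_ennreal divide_nonneg_pos integral_nonneg_AE) auto
  have "(\<integral>x. indicator (space p) x * w x \<partial>p) = ?W"
    by (intro Bochner_Integration.integral_cong) auto
  then show "prob_space (reweight p w)"
    using em[of "space p"] pos by (intro prob_spaceI) (simp add: reweight_def)
qed

lemma sets_reweight [simp]: "sets (reweight p w) = sets p"
  by (simp add: reweight_def)

section \<open>Rejection sampling as reweighting\<close>

text \<open>Passing to complements reverses the inequality, both total masses being 1. The law of
  the rejection sampler can thus be identified from lower bounds alone.\<close>

lemma prob_space_eqI:
  assumes "prob_space M" "prob_space N" and sets: "sets M = sets N"
    and le: "\<And>A. A \<in> sets M \<Longrightarrow> measure N A \<le> measure M A"
  shows "M = N"
proof (rule measure_eqI[OF sets])
  interpret M: prob_space M by fact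
  interpret N: prob_space N by fact
  fix A assume A: "A \<in> sets M"
  have "measure N (space N - A) \<le> measure M (space M - A)"
    using le[OF sets.compl_sets[OF A]] sets_eq_imp_space_eq[OF sets] by simp
  then have "measure M A \<le> measure N A"
    using A sets by (simp add: M.prob_compl N.prob_compl)
  with le[OF A] show "emeasure M A = emeasure N A"
    by (simp add: M.emeasure_eq_measure N.emeasure_eq_measure)
qed

text \<open>By Tonelli: over a proposal \<open>x\<close> in \<open>A\<close> the slice of the event
  is \<open>{..acc x}\<close>, to which the uniform law gives mass \<open>acc x\<close> because this
  value lies in the unit interval.\<close>

lemma measure_accept:
  assumes p: "prob_space p" and acc[measurable]: "acc \<in> borel_measurable p"
    and acc01: "\<And>x. x \<in> space p \<Longrightarrow> acc x \<in> {0..1}" and A[measurable]: "A \<in> sets p"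
  shows "measure (p \<Otimes>\<^sub>M uniform_measure lborel {0..1::real})
      {z \<in> space (p \<Otimes>\<^sub>M uniform_measure lborel {0..1::real}). fst z \<in> A \<and> snd z \<le> acc (fst z)}
    = (\<integral>x. indicator A x * acc x \<partial>p)"
proof -
  let ?U = "uniform_measure lborel {0..1::real}"
  interpret p: prob_space p by fact
  interpret U: prob_space ?U by (rule prob_space_uniform_measure) auto
  let ?S = "{z \<in> space (p \<Otimes>\<^sub>M ?U). fst z \<in> A \<and> snd z \<le> acc (fst z)}"
  have S[measurable]: "?S \<in> sets (p \<Otimes>\<^sub>M ?U)" by measurable
  have "emeasure (p \<Otimes>\<^sub>M ?U) ?S = (\<integral>\<^sup>+x. emeasure ?U (Pair x -` ?S) \<partial>p)"
    by (rule U.emeasure_pair_measure_alt[OF S])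
  also have "\<dots> = (\<integral>\<^sup>+x. ennreal (indicator A x * acc x) \<partial>p)"
  proof (intro nn_integral_cong)
    fix x assume x: "x \<in> space p"
    have "Pair x -` ?S = (if x \<in> A then {..acc x} else {})"
      using x by (auto simp: space_pair_measure)
    moreover have "emeasure ?U {..acc x} = ennreal (acc x)"
    proof -
      have "{0..1} \<inter> {..acc x} = {0..acc x}" using acc01[OF x] by auto
      then show ?thesis using acc01[OF x]
        by (subst emeasure_uniform_measure) (auto simp: divide_ennreal_def)
    qed
    ultimately show "emeasure ?U (Pair x -` ?S) = ennreal (indicator A x * acc x)" by simp
  qed
  also have "\<dots> = ennreal (\<integral>x. indicator A x * acc x \<partial>p)"
    using acc01 by (intro nn_integral_eq_integral p.integrable_const_bound[where B=1])
      (auto simp: indicator_def)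
  finally show ?thesis
    using acc01 by (auto simp: measure_def indicator_def intro!: enn2real_ennreal integral_nonneg_AE)
qed

text \<open>The events of \<open>n\<close> rejections followed by an acceptance in \<open>A\<close>
  are disjoint with probabilities \<open>(1 - Z) ^ n * a\<close>, which sum to \<open>a / Z\<close>.
  On each of them the output lies in \<open>A\<close>, so \<open>a / Z\<close> is a lower bound;
  \<open>prob_space_eqI\<close> makes it an equality, without a separate treatment of the sequences
  in which nothing is accepted.\<close>

lemma rejection_law_eq_reweight:
  fixes p :: "'a measure"
  assumes p: "prob_space p" and acc[measurable]: "acc \<in> borel_measurable p"
    and acc01: "\<And>x. x \<in> space p \<Longrightarrow> acc x \<in> {0..1}" and pos: "0 < (\<integral>x. acc x \<partial>p)"
  shows "rejection_law p acc = reweight p acc"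
proof -
  define U where "U = uniform_measure lborel {0..1::real}"
  define M where "M = p \<Otimes>\<^sub>M U"
  define Z where "Z = (\<integral>x. acc x \<partial>p)"
  interpret p: prob_space p by fact
  have "prob_space U" unfolding U_def by (rule prob_space_uniform_measure) auto
  then interpret M: prob_space M unfolding M_def by (intro prob_space_pair p)
  interpret P: product_prob_space "\<lambda>_::nat. M" UNIV by unfold_locales
  let ?P = "\<Pi>\<^sub>M n\<in>(UNIV::nat set). M"
  have [measurable_cong]: "sets U = sets borel" by (simp add: U_def)
  have [measurable]: "fst \<in> M \<rightarrow>\<^sub>M p" "snd \<in> M \<rightarrow>\<^sub>M borel" unfolding M_def by measurable
  define S where "S A = {z \<in> space M. fst z \<in> A \<and> snd z \<le> acc (fst z)}" for A
  have [measurable]: "S A \<in> sets M" if [measurable]: "A \<in> sets p" for A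
    unfolding S_def by measurable
  have S_meas: "M.prob (S A) = (\<integral>x. indicator A x * acc x \<partial>p)" if "A \<in> sets p" for A
    using measure_accept[OF p acc acc01 that] by (simp add: S_def M_def U_def)
  have S_space: "M.prob (S (space p)) = Z"
    unfolding S_meas[OF sets.top] Z_def by (intro Bochner_Integration.integral_cong) auto
  \<comment> \<open>\<open>Z\<close> is the probability that a single proposal is accepted, hence at
    most 1; together with \<open>0 < Z\<close> this places the ratio \<open>1 - Z\<close> of the
    geometric series in [0, 1).\<close>
  have Z: "0 < Z" "Z \<le> 1" using pos M.prob_le_1[of "S (space p)"] by (simp_all add: Z_def S_space[unfolded Z_def])
  let ?first = "\<lambda>s. fst (s (LEAST n. snd (s n) \<le> acc (fst (s n))))"
  \<comment> \<open>The index given by \<open>LEAST\<close> is a measurable function into a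
    countable type, so reading off the coordinate at that index stays measurable.\<close>
  have first[measurable]: "?first \<in> ?P \<rightarrow>\<^sub>M p"
    by (rule measurable_compose_countable[of "\<lambda>n s. fst (s n)"]) measurable
  have rej: "rejection_law p acc = distr ?P p ?first"
    by (simp add: rejection_law_def M_def U_def)
  have iacc: "integrable p acc"
    using acc01 by (intro p.integrable_const_bound[where B=1]) auto
  show ?thesis unfolding rej
  proof (rule prob_space_eqI)
    show "prob_space (distr ?P p ?first)" by (rule P.P.prob_space_distr[OF first])
    show "prob_space (reweight p acc)"
      using acc01 by (intro prob_space_reweight[OF p acc _ iacc pos]) auto
    show "sets (distr ?P p ?first) = sets (reweight p acc)" by simp
    fix A assume "A \<in> sets (distr ?P p ?first)"
    then have A[measurable]: "A \<in> sets p" by simp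
    define a where "a = (\<integral>x. indicator A x * acc x \<partial>p)"
    define F where "F n i = (if i < n then space M - S (space p) else S A)" for n i :: nat
    \<comment> \<open>\<open>E n\<close>: the \<open>n\<close>-th proposal is the first accepted one, and it lies in \<open>A\<close>.\<close>
    define E where "E n = prod_emb UNIV (\<lambda>_. M) {..n} (Pi\<^sub>E {..n} (F n))" for n
    have F[measurable]: "F n i \<in> sets M" for n i by (simp add: F_def)
    have E_sets: "E n \<in> sets ?P" for n unfolding E_def by (rule sets_PiM_I) auto
    have E_iff: "s \<in> E n \<longleftrightarrow> s \<in> space ?P \<and> (\<forall>i\<le>n. s i \<in> F n i)" for s n
      by (auto simp: E_def prod_emb_def space_PiM PiE_def restrict_def Pi_iff extensional_def)
    have E_prob: "P.P.prob (E n) = (1 - Z) ^ n * a" for n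
    proof -
      have "P.P.prob (E n) = (\<Prod>i\<le>n. M.prob (F n i))"
        unfolding E_def by (rule P.measure_PiM_emb) auto
      also have "\<dots> = (\<Prod>i<n. M.prob (F n i)) * M.prob (F n n)"
        by (simp add: lessThan_Suc_atMost[symmetric])
      also have "(\<Prod>i<n. M.prob (F n i)) = (\<Prod>i<n. 1 - Z)"
        by (intro prod.cong) (auto simp: F_def M.prob_compl S_space)
      finally show ?thesis by (simp add: F_def S_meas a_def)
    qed
    have disj: "disjoint_family E"
    proof -
      \<comment> \<open>The proposal with the smaller index \<open>m\<close> would be accepted
        according to \<open>E m\<close> and rejected according to \<open>E n\<close>.\<close>
      have False if "s \<in> E m" "s \<in> E n" "m < n" for s m n
      proof -
        have "s m \<in> S A" "s m \<notin> S (space p)" using that by (auto simp: E_iff F_def split: if_splits dest!: spec[of _ m])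
        then show False by (auto simp: S_def M_def space_pair_measure)
      qed
      then show ?thesis unfolding disjoint_family_on_def
        by (metis Int_iff equals0I linorder_neqE_nat)
    qed
    have least: "E n \<subseteq> ?first -` A \<inter> space ?P" for n
    proof
      fix s assume s: "s \<in> E n"
      then have sp: "s i \<in> space M" for i by (auto simp: E_iff space_PiM)
      have lt: "s i \<notin> S (space p)" if "i < n" for i
        using s that by (auto simp: E_iff F_def split: if_splits dest!: spec[of _ i])
      have n: "s n \<in> S A" using s by (auto simp: E_iff F_def dest!: spec[of _ n])
      have "(LEAST n. snd (s n) \<le> acc (fst (s n))) = n"
      proof (rule Least_equality)
        show "snd (s n) \<le> acc (fst (s n))" using n by (simp add: S_def)
        show "n \<le> j" if "snd (s j) \<le> acc (fst (s j))" for j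
          using lt[of j] sp[of j] that by (force simp: S_def M_def space_pair_measure not_less[symmetric])
      qed
      then show "s \<in> ?first -` A \<inter> space ?P" using n s by (simp add: S_def E_iff)
    qed
    have "(\<lambda>n. (1 - Z) ^ n * a) sums (1 / (1 - (1 - Z)) * a)"
      using Z by (intro sums_mult2 geometric_sums) auto
    moreover have "(\<lambda>n. P.P.prob (E n)) sums P.P.prob (\<Union>n. E n)"
      using E_sets disj by (intro P.P.finite_measure_UNION) auto
    ultimately have "P.P.prob (\<Union>n. E n) = a / Z"
      by (simp add: E_prob sums_iff)
    moreover have "P.P.prob (\<Union>n. E n) \<le> P.P.prob (?first -` A \<inter> space ?P)"
      using least by (intro P.P.finite_measure_mono) auto
    ultimately show "measure (reweight p acc) A \<le> measure (distr ?P p ?first) A"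
      using acc01 by (subst measure_reweight[OF p acc _ iacc pos A]) (auto simp: measure_distr a_def Z_def)
  qed
qed

section \<open>Measurability of the sampling steps as kernels\<close>

text \<open>The normalizer is an integral against a kernel, hence measurable in the parameter; the
  mass of a fixed set is then again such an integral, of the normalized weight.\<close>

lemma measurable_reweight:
  assumes K[measurable]: "K \<in> M \<rightarrow>\<^sub>M prob_algebra N"
    and w[measurable]: "case_prod w \<in> borel_measurable (M \<Otimes>\<^sub>M N)"
    and nonneg: "\<And>y x. y \<in> space M \<Longrightarrow> x \<in> space N \<Longrightarrow> 0 \<le> w y x"
    and int: "\<And>y. y \<in> space M \<Longrightarrow> integrable (K y) (w y)"
    and pos: "\<And>y. y \<in> space M \<Longrightarrow> 0 < (\<integral>x. w y x \<partial>K y)"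
  shows "(\<lambda>y. reweight (K y) (w y)) \<in> M \<rightarrow>\<^sub>M prob_algebra N"
proof (rule measurable_prob_algebraI)
  have K': "prob_space (K y)" "sets (K y) = sets N" if "y \<in> space M" for y
    using measurable_space[OF K that] by (auto simp: space_prob_algebra)
  have wy: "w y \<in> borel_measurable (K y)" if "y \<in> space M" for y
    using K'(2)[OF that] measurable_Pair2[OF w that] by (simp cong: measurable_cong_sets)
  show prob: "prob_space (reweight (K y) (w y))" if "y \<in> space M" for y
    using that K'[OF that] nonneg sets_eq_imp_space_eq[OF K'(2)[OF that]]
    by (intro prob_space_reweight wy int pos) auto
  \<comment> \<open>Nonnegativity of the weight turns the Bochner integral into a nonnegative
    integral, whose dependence on the kernel is known to be measurable.\<close>
  have [measurable]: "(\<lambda>y. \<integral>x. w y x \<partial>K y) \<in> borel_measurable M"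
  proof (subst measurable_cong)
    show "(\<integral>x. w y x \<partial>K y) = enn2real (\<integral>\<^sup>+x. ennreal (w y x) \<partial>K y)" if "y \<in> space M" for y
      using that nonneg sets_eq_imp_space_eq[OF K'(2)[OF that]]
      by (intro integral_eq_nn_integral wy) auto
    have "(\<lambda>y. \<integral>\<^sup>+x. ennreal (w y x) \<partial>K y) \<in> borel_measurable M"
      by (rule nn_integral_measurable_subprob_algebra2[OF _ measurable_prob_algebraD[OF K]]) measurable
    then show "(\<lambda>y. enn2real (\<integral>\<^sup>+x. ennreal (w y x) \<partial>K y)) \<in> borel_measurable M" by measurable
  qed
  show "(\<lambda>y. reweight (K y) (w y)) \<in> M \<rightarrow>\<^sub>M subprob_algebra N"
  proof (rule measurable_subprob_algebra)
    fix A assume [measurable]: "A \<in> sets N"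
    have "emeasure (reweight (K y) (w y)) A =
        (\<integral>\<^sup>+x. ennreal (w y x / (\<integral>z. w y z \<partial>K y)) * indicator A x \<partial>K y)"
      if "y \<in> space M" for y
      unfolding reweight_def using wy[OF that] K'(2)[OF that]
      by (subst emeasure_density) auto
    moreover have "(\<lambda>y. \<integral>\<^sup>+x. ennreal (w y x / (\<integral>z. w y z \<partial>K y)) * indicator A x \<partial>K y)
        \<in> borel_measurable M"
      by (rule nn_integral_measurable_subprob_algebra2[OF _ measurable_prob_algebraD[OF K]]) measurable
    ultimately show "(\<lambda>y. emeasure (reweight (K y) (w y)) A) \<in> borel_measurable M"
      by (simp cong: measurable_cong)
  qed (use prob K' in \<open>auto intro: prob_space_imp_subprob_space\<close>)
qed


text \<open>A positive function with integral 0 would vanish almost everywhere, which is impossible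
  on a space of total mass 1.\<close>

lemma (in prob_space) integral_pos:
  fixes w :: "'a \<Rightarrow> real"
  assumes int: "integrable M w" and pos: "\<And>x. x \<in> space M \<Longrightarrow> 0 < w x"
  shows "0 < (\<integral>x. w x \<partial>M)"
proof -
  have nonneg: "AE x in M. 0 \<le> w x" using pos by (auto intro: less_imp_le)
  have "(\<integral>x. w x \<partial>M) \<noteq> 0"
  proof
    assume "(\<integral>x. w x \<partial>M) = 0"
    then have "AE x in M. w x = 0" using integral_nonneg_eq_0_iff_AE[OF int nonneg] by simp
    then have "AE x in M. False"
      by (rule AE_mp) (rule AE_I2, use pos in \<open>fastforce\<close>)
    then show False by simp
  qed
  moreover have "0 \<le> (\<integral>x. w x \<partial>M)" using nonneg by (rule integral_nonneg_AE)
  ultimately show ?thesis by simp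
qed

lemma baseline_step_eq_reweight:
  assumes p: "prob_space p" and f[measurable]: "f \<in> borel_measurable p"
  shows "baseline_step p f \<beta> = reweight p (\<lambda>x. min 1 (exp (f x - \<beta>)))"
proof -
  interpret prob_space p by fact
  have "integrable p (\<lambda>x. min 1 (exp (f x - \<beta>)))"
    by (rule integrable_const_bound[where B=1]) auto
  then have "0 < (\<integral>x. min 1 (exp (f x - \<beta>)) \<partial>p)" by (rule integral_pos) simp
  then show ?thesis
    unfolding baseline_step_def by (intro rejection_law_eq_reweight p) auto
qed

text \<open>The infinite product in \<open>rejection_law\<close> is awkward to vary with a
  parameter, so each step is first rewritten as a reweighting of its proposal kernel.\<close>

lemma measurable_baseline_step:
  assumes K[measurable]: "K \<in> M \<rightarrow>\<^sub>M prob_algebra N" and f[measurable]: "f \<in> borel_measurable N"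
    and \<beta>[measurable]: "\<beta> \<in> borel_measurable M"
  shows "(\<lambda>y. baseline_step (K y) f (\<beta> y)) \<in> M \<rightarrow>\<^sub>M prob_algebra N"
proof (subst measurable_cong)
  have K': "prob_space (K y)" "f \<in> borel_measurable (K y)" if "y \<in> space M" for y
  proof -
    have "sets (K y) = sets N" "prob_space (K y)"
      using measurable_space[OF K that] by (auto simp: space_prob_algebra)
    then show "prob_space (K y)" "f \<in> borel_measurable (K y)"
      using f by (simp_all cong: measurable_cong_sets)
  qed
  show "baseline_step (K y) f (\<beta> y) = reweight (K y) (\<lambda>x. min 1 (exp (f x - \<beta> y)))"
    if "y \<in> space M" for y
    using K'[OF that] by (rule baseline_step_eq_reweight)
  have int: "integrable (K y) (\<lambda>x. min 1 (exp (f x - \<beta> y)))" if "y \<in> space M" for y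
  proof -
    interpret prob_space "K y" using K'[OF that] by simp
    have [measurable]: "f \<in> borel_measurable (K y)" using K'[OF that] by simp
    show ?thesis by (rule integrable_const_bound[where B=1]) auto
  qed
  show "(\<lambda>y. reweight (K y) (\<lambda>x. min 1 (exp (f x - \<beta> y)))) \<in> M \<rightarrow>\<^sub>M prob_algebra N"
    using K' int by (intro measurable_reweight K prob_space.integral_pos) auto
qed

section \<open>Total variation error of one step\<close>

text \<open>Applying the one-sided bound to the complement of a set yields the opposite sign, which
  disposes of the absolute value.\<close>

lemma tv_dist_le:
  assumes "prob_space M" "prob_space N" and sets: "sets M = sets N"
    and le: "\<And>A. A \<in> sets M \<Longrightarrow> measure M A - measure N A \<le> C"
  shows "tv_dist M N \<le> C"
  unfolding tv_dist_def
proof (rule cSUP_least)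
  interpret M: prob_space M by fact
  interpret N: prob_space N by fact
  show "sets M \<noteq> {}" by auto
  fix A assume A: "A \<in> sets M"
  have "measure M (space M - A) - measure N (space N - A) \<le> C"
    using le[OF sets.compl_sets[OF A]] sets_eq_imp_space_eq[OF sets] by simp
  then have "measure N A - measure M A \<le> C"
    using A sets by (simp add: M.prob_compl N.prob_compl)
  with le[OF A] show "\<bar>measure M A - measure N A\<bar> \<le> C" by simp
qed

lemma (in prob_space) integrable_exp_bounded:
  fixes f :: "'a \<Rightarrow> real"
  assumes [measurable]: "f \<in> borel_measurable M" and le: "\<And>x. x \<in> space M \<Longrightarrow> f x \<le> C"
  shows "integrable M (\<lambda>x. exp (f x))"
  by (rule integrable_const_bound[where B="exp C"]) (use le in auto)

text \<open>With \<open>a x = min 1 (exp (f x - \<beta>))\<close>, the product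
  \<open>exp \<beta> * a x\<close> is the tilting weight \<open>exp (f x)\<close> cut off at
  \<open>exp \<beta>\<close>. Hence the unnormalized mass of the target on any set is at least
  \<open>exp \<beta>\<close> times that of the sampler, and over the whole space the difference is
  the integral of the part cut off.\<close>

lemma tv_dist_baseline_step:
  assumes p: "prob_space p" and f[measurable]: "f \<in> borel_measurable p"
    and int: "integrable p (\<lambda>x. exp (f x))"
  shows "tv_dist (baseline_step p f \<beta>) (reweight p (\<lambda>x. exp (f x)))
    \<le> (\<integral>x. max 0 (exp (f x) - exp \<beta>) \<partial>p) / (\<integral>x. exp (f x) \<partial>p)"
proof -
  interpret prob_space p by fact
  define a where "a x = min 1 (exp (f x - \<beta>))" for x
  define Z where "Z = (\<integral>x. a x \<partial>p)"
  define W where "W = (\<integral>x. exp (f x) \<partial>p)"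
  have [measurable]: "a \<in> borel_measurable p" unfolding a_def by measurable
  have a_int: "integrable p a"
    by (rule integrable_const_bound[where B=1]) (auto simp: a_def)
  have a_pos: "0 < a x" for x by (simp add: a_def)
  have Z: "0 < Z" unfolding Z_def by (rule integral_pos[OF a_int a_pos])
  have W: "0 < W" unfolding W_def by (rule integral_pos[OF int]) simp
  have ba: "exp \<beta> * a x = exp (f x) - max 0 (exp (f x) - exp \<beta>)" for x
    by (auto simp: a_def min_def max_def exp_diff)
  have excess: "(\<integral>x. max 0 (exp (f x) - exp \<beta>) \<partial>p) = W - exp \<beta> * Z"
  proof -
    have "max 0 (exp (f x) - exp \<beta>) = exp (f x) - exp \<beta> * a x" for x using ba by simp
    then show ?thesis unfolding W_def Z_def using int a_int by simp
  qed
  have gap: "0 \<le> W - exp \<beta> * Z"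
    unfolding excess[symmetric] by (intro integral_nonneg_AE) auto
  have bs: "baseline_step p f \<beta> = reweight p a"
    using baseline_step_eq_reweight[OF p f] by (simp add: a_def[abs_def])
  show ?thesis unfolding bs excess W_def[symmetric]
  proof (rule tv_dist_le)
    show "prob_space (reweight p a)"
      by (intro prob_space_reweight p a_int) (use a_pos Z in \<open>auto simp: Z_def intro: less_imp_le\<close>)
    show "prob_space (reweight p (\<lambda>x. exp (f x)))"
      by (intro prob_space_reweight p int) (use W in \<open>auto simp: W_def\<close>)
    show "sets (reweight p a) = sets (reweight p (\<lambda>x. exp (f x)))" by simp
    fix A assume "A \<in> sets (reweight p a)"
    then have A[measurable]: "A \<in> sets p" by simp
    define I where "I = (\<integral>x. indicator A x * a x \<partial>p)"
    have iA: "integrable p (\<lambda>x. indicator A x * a x)" "integrable p (\<lambda>x. indicator A x * exp (f x))"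
      using integrable_mult_indicator[OF A a_int] integrable_mult_indicator[OF A int] by simp_all
    have "exp \<beta> * I \<le> (\<integral>x. indicator A x * exp (f x) \<partial>p)"
      unfolding I_def integral_mult_right_zero[symmetric]
    proof (rule integral_mono)
      show "exp \<beta> * (indicator A x * a x) \<le> indicator A x * exp (f x)" for x
        using ba[of x] by (auto simp: indicator_def)
    qed (use iA in auto)
    moreover have "I \<le> Z" unfolding I_def Z_def
      by (rule integral_mono[OF iA(1) a_int]) (use a_pos in \<open>auto simp: indicator_def intro: less_imp_le\<close>)
    ultimately have "I / Z - (\<integral>x. indicator A x * exp (f x) \<partial>p) / W \<le> I / Z - exp \<beta> * I / W"
      and "I / Z \<le> 1"
      using W Z by (simp_all add: divide_right_mono)
    note this(1)
    \<comment> \<open>The factor \<open>I / Z\<close> is the probability of \<open>A\<close> under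
      the sampler, so it is at most 1; the other factor is the share of \<open>W\<close> lost by
      clipping.\<close>
    also have "I / Z - exp \<beta> * I / W = (I / Z) * ((W - exp \<beta> * Z) / W)"
      using W Z by (simp add: field_simps)
    also have "\<dots> \<le> 1 * ((W - exp \<beta> * Z) / W)"
      using \<open>I / Z \<le> 1\<close> gap W by (intro mult_right_mono) auto
    also have "I = (\<integral>x. indicator A x * a x \<partial>p)" by (simp add: I_def)
    finally show "measure (reweight p a) A - measure (reweight p (\<lambda>x. exp (f x))) A
        \<le> (W - exp \<beta> * Z) / W"
      using Z W a_pos
      by (subst (1 2) measure_reweight) (auto intro: p a_int int A less_imp_le simp: Z_def W_def)
  qed
qed

section \<open>Exponential moment inequalities\<close>

text \<open>The ratio is controlled by an upper-tail moment unless the normalizer is small; in that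
  case the trivial bound 1 is paid for by the lower-tail moment in the second summand. The threshold
  parameter \<open>k\<close> is left free for a later choice.\<close>

lemma (in prob_space) clipped_excess_le:
  fixes s :: "'a \<Rightarrow> real" and k l :: real
  assumes [measurable]: "s \<in> borel_measurable M" and s: "\<And>x. x \<in> space M \<Longrightarrow> \<bar>s x\<bar> \<le> C"
    and l: "1 \<le> l"
  shows "(\<integral>x. max 0 (exp (s x) - 1) \<partial>M) / (\<integral>x. exp (s x) \<partial>M)
    \<le> (\<integral>x. exp k * exp (l * s x) + exp (- l * (k + s x)) \<partial>M)"
proof -
  define W where "W = (\<integral>x. exp (s x) \<partial>M)"
  have i0: "integrable M (\<lambda>x. exp (s x))"
    by (rule integrable_exp_bounded[where C=C]) (use s in \<open>auto simp: abs_le_iff\<close>)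
  have i1: "integrable M (\<lambda>x. exp (l * s x))"
    by (rule integrable_exp_bounded[where C="l * C"])
       (use s l in \<open>auto simp: abs_le_iff intro!: mult_left_mono\<close>)
  have i2: "integrable M (\<lambda>x. exp (- l * (k + s x)))"
  proof (rule integrable_exp_bounded[where C="l * (C - k)"])
    fix x assume "x \<in> space M"
    then have "l * - (k + s x) \<le> l * (C - k)"
      using s[of x] l by (intro mult_left_mono) auto
    then show "- l * (k + s x) \<le> l * (C - k)" by (simp add: algebra_simps)
  qed simp
  have i3: "integrable M (\<lambda>x. max 0 (exp (s x) - 1))"
    by (rule Bochner_Integration.integrable_bound[OF i0]) auto
  have W: "0 < W" unfolding W_def by (rule integral_pos[OF i0]) simp
  show ?thesis
  proof (cases "exp (- k) \<le> W")
    \<comment> \<open>Here dividing by \<open>W\<close> costs at most a factor \<open>exp k\<close>,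
      and the clipped excess is at most \<open>exp (l * s x)\<close> because \<open>l\<close> is at
      least 1.\<close>
    case True
    then have "1 \<le> exp k * W" by (simp add: exp_minus field_simps)
    then have "1 / W \<le> exp k" using W by (simp add: field_simps)
    moreover have nonneg: "0 \<le> (\<integral>x. max 0 (exp (s x) - 1) \<partial>M)" by (intro integral_nonneg_AE) auto
    ultimately have "(\<integral>x. max 0 (exp (s x) - 1) \<partial>M) * (1 / W)
        \<le> (\<integral>x. max 0 (exp (s x) - 1) \<partial>M) * exp k"
      by (intro mult_left_mono)
    also have "\<dots> = (\<integral>x. exp k * max 0 (exp (s x) - 1) \<partial>M)" by simp
    also have "\<dots> \<le> (\<integral>x. exp k * exp (l * s x) + exp (- l * (k + s x)) \<partial>M)"
    proof (intro integral_mono)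
      fix x
      have "exp (s x) - 1 \<le> exp (l * s x)"
      proof (cases "0 \<le> s x")
        case True
        then have "s x \<le> l * s x" using l mult_right_mono[of 1 l "s x"] by simp
        then have "exp (s x) \<le> exp (l * s x)" by simp
        then show ?thesis by linarith
      next
        case False
        then have "exp (s x) \<le> 1" by simp
        then show ?thesis using exp_ge_zero[of "l * s x"] by linarith
      qed
      then have "exp k * max 0 (exp (s x) - 1) \<le> exp k * exp (l * s x)"
        by (intro mult_left_mono) auto
      then show "exp k * max 0 (exp (s x) - 1) \<le> exp k * exp (l * s x) + exp (- l * (k + s x))"
        using exp_ge_zero[of "- l * (k + s x)"] by linarith
    qed (use i1 i2 i3 in auto)
    finally show ?thesis by (simp add: W_def)
  next
    case False
    have "(\<integral>x. max 0 (exp (s x) - 1) \<partial>M) \<le> W"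
      unfolding W_def by (intro integral_mono i3 i0) auto
    then have "(\<integral>x. max 0 (exp (s x) - 1) \<partial>M) / W \<le> 1" using W by simp
    \<comment> \<open>The constant 1 is traded for the mean of an affine function of
      \<open>exp (s x)\<close>. Pointwise this function is below
      \<open>exp (- l * (k + s x))\<close>, by \<open>1 + z \<le> exp z\<close> at
      \<open>z = k + s x\<close> and then at \<open>z = - l * (k + s x)\<close>.\<close>
    also have "1 \<le> 1 + l * (1 - exp k * W)"
      using False l by (simp add: exp_minus field_simps)
    also have "\<dots> = (\<integral>x. 1 + l * (1 - exp k * exp (s x)) \<partial>M)"
      using i0 by (simp add: prob_space W_def)
    also have "\<dots> \<le> (\<integral>x. exp k * exp (l * s x) + exp (- l * (k + s x)) \<partial>M)"
    proof (intro integral_mono)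
      fix x
      have "k + s x \<le> exp (k + s x) - 1" using exp_ge_add_one_self[of "k + s x"] by linarith
      then have "l * (k + s x) \<le> l * (exp (k + s x) - 1)" using l by (intro mult_left_mono) auto
      then have "1 + l * (1 - exp k * exp (s x)) \<le> 1 + - l * (k + s x)"
        by (simp add: exp_add algebra_simps)
      also have "\<dots> \<le> exp (- l * (k + s x))" by (rule exp_ge_add_one_self)
      also have "\<dots> \<le> exp k * exp (l * s x) + exp (- l * (k + s x))" by simp
      finally show "1 + l * (1 - exp k * exp (s x)) \<le> exp k * exp (l * s x) + exp (- l * (k + s x))" .
    qed (use i0 i1 i2 in auto)
    finally show ?thesis by (simp add: W_def)
  qed
qed

text \<open>Jensen's inequality for \<open>s\<close> and for \<open>- s\<close> gives two lower
  bounds with product 1. This is what makes the Chernoff objective nonnegative.\<close>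

lemma (in prob_space) integral_exp_mult_integral_exp_minus:
  fixes s :: "'a \<Rightarrow> real"
  assumes s: "integrable M s" "integrable M (\<lambda>x. exp (s x))" "integrable M (\<lambda>x. exp (- s x))"
  shows "1 \<le> (\<integral>x. exp (s x) \<partial>M) * (\<integral>x. exp (- s x) \<partial>M)"
proof -
  have exp_le: "exp (\<integral>x. u x \<partial>M) \<le> (\<integral>x. exp (u x) \<partial>M)"
    if u: "integrable M u" "integrable M (\<lambda>x. exp (u x))" for u :: "'a \<Rightarrow> real"
    using u exp_convex by (intro jensens_inequality[where I=UNIV]) auto
  have "1 = exp (\<integral>x. s x \<partial>M) * exp (\<integral>x. - s x \<partial>M)" by (simp add: exp_minus)
  also have "\<dots> \<le> (\<integral>x. exp (s x) \<partial>M) * (\<integral>x. exp (- s x) \<partial>M)"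
    using s by (intro mult_mono exp_le integral_nonneg_AE) auto
  finally show ?thesis .
qed

section \<open>Integration against the joint law of two consecutive states\<close>

text \<open>Pushing \<open>K y\<close> forward along \<open>Pair y\<close> is a Markov kernel into
  the product space, so \<open>joint_law\<close> is a bind of kernels, and integrals against a bind
  are iterated integrals.\<close>

lemma
  assumes q: "q \<in> space (prob_algebra X)" and K[measurable]: "K \<in> X \<rightarrow>\<^sub>M prob_algebra X"
  shows prob_space_joint_law: "prob_space (joint_law X q K)"
    and sets_joint_law: "sets (joint_law X q K) = sets (X \<Otimes>\<^sub>M X)"
    and nn_integral_joint_law: "g \<in> borel_measurable (X \<Otimes>\<^sub>M X) \<Longrightarrow>
      (\<integral>\<^sup>+z. g z \<partial>joint_law X q K) = (\<integral>\<^sup>+y. \<integral>\<^sup>+x. g (y, x) \<partial>K y \<partial>q)"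
proof -
  have q': "sets q = sets X" "prob_space q" using q by (auto simp: space_prob_algebra)
  have K': "sets (K y) = sets X" "prob_space (K y)" if "y \<in> space X" for y
    using measurable_space[OF K that] by (auto simp: space_prob_algebra)
  have pair: "Pair y \<in> K y \<rightarrow>\<^sub>M X \<Otimes>\<^sub>M X" if "y \<in> space X" for y
    using that K'(1)[OF that] measurable_Pair1'[of y X X] by (simp cong: measurable_cong_sets)
  have ker: "(\<lambda>y. distr (K y) (X \<Otimes>\<^sub>M X) (Pair y)) \<in> X \<rightarrow>\<^sub>M prob_algebra (X \<Otimes>\<^sub>M X)"
    using K' pair
    by (intro measurable_prob_algebraI measurable_distr2[where M=X] prob_space.prob_space_distr
        measurable_prob_algebraD[OF K]) auto
  then have ker': "(\<lambda>y. distr (K y) (X \<Otimes>\<^sub>M X) (Pair y)) \<in> q \<rightarrow>\<^sub>M subprob_algebra (X \<Otimes>\<^sub>M X)"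
    using q'(1) by (auto intro!: measurable_prob_algebraD cong: measurable_cong_sets)
  have "joint_law X q K \<in> space (prob_algebra (X \<Otimes>\<^sub>M X))"
    unfolding joint_law_def
    using measurable_space[OF measurable_bind_prob_space[OF measurable_ident ker] q] by simp
  then show "prob_space (joint_law X q K)" "sets (joint_law X q K) = sets (X \<Otimes>\<^sub>M X)"
    by (simp_all add: space_prob_algebra)
  assume [measurable]: "g \<in> borel_measurable (X \<Otimes>\<^sub>M X)"
  show "(\<integral>\<^sup>+z. g z \<partial>joint_law X q K) = (\<integral>\<^sup>+y. \<integral>\<^sup>+x. g (y, x) \<partial>K y \<partial>q)"
    unfolding joint_law_def using sets_eq_imp_space_eq[OF q'(1)]
    by (subst nn_integral_bind[OF _ ker'])
       (auto intro!: nn_integral_cong simp: nn_integral_distr[OF pair])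
qed

text \<open>Boundedness and nonnegativity make every integral involved finite and equal to its
  \<open>ennreal\<close> counterpart, so the iterated formula carries over to Bochner integrals. It
  links conditional bounds to the population expectation.\<close>

lemma integral_joint_law:
  fixes g :: "'a \<times> 'a \<Rightarrow> real"
  assumes q: "q \<in> space (prob_algebra X)" and K[measurable]: "K \<in> X \<rightarrow>\<^sub>M prob_algebra X"
    and g[measurable]: "g \<in> borel_measurable (X \<Otimes>\<^sub>M X)"
    and bounded: "\<And>z. z \<in> space (X \<Otimes>\<^sub>M X) \<Longrightarrow> 0 \<le> g z \<and> g z \<le> C"
  shows "integrable q (\<lambda>y. \<integral>x. g (y, x) \<partial>K y)"
    and "(\<integral>y. \<integral>x. g (y, x) \<partial>K y \<partial>q) = (\<integral>z. g z \<partial>joint_law X q K)"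
proof -
  note J = prob_space_joint_law[OF q K] sets_joint_law[OF q K]
  interpret q: prob_space q using q by (simp add: space_prob_algebra)
  interpret Q: prob_space "joint_law X q K" by fact
  have q': "sets q = sets X" using q by (simp add: space_prob_algebra)
  note spq = sets_eq_imp_space_eq[OF q'] and spQ = sets_eq_imp_space_eq[OF J(2)]
  have gQ[measurable]: "g \<in> borel_measurable (joint_law X q K)"
    using J(2) by (simp cong: measurable_cong_sets)
  have inner: "ennreal (\<integral>x. g (y, x) \<partial>K y) = (\<integral>\<^sup>+x. ennreal (g (y, x)) \<partial>K y)"
    and inner_bound: "0 \<le> (\<integral>x. g (y, x) \<partial>K y) \<and> (\<integral>x. g (y, x) \<partial>K y) \<le> C"
    if y: "y \<in> space X" for y
  proof -
    have K': "sets (K y) = sets X" "prob_space (K y)"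
      using measurable_space[OF K y] by (auto simp: space_prob_algebra)
    interpret prob_space "K y" by (rule K')
    have b: "0 \<le> g (y, x) \<and> g (y, x) \<le> C" if "x \<in> space (K y)" for x
      using that y bounded[of "(y, x)"] sets_eq_imp_space_eq[OF K'(1)] by (simp add: space_pair_measure)
    have "(\<lambda>x. g (y, x)) \<in> borel_measurable (K y)"
      using measurable_Pair2[OF g y] K'(1) by (simp cong: measurable_cong_sets)
    then have i: "integrable (K y) (\<lambda>x. g (y, x))"
      using b by (intro integrable_const_bound[where B=C]) auto
    show "ennreal (\<integral>x. g (y, x) \<partial>K y) = (\<integral>\<^sup>+x. ennreal (g (y, x)) \<partial>K y)"
      using b by (intro nn_integral_eq_integral[symmetric] i) auto
    show "0 \<le> (\<integral>x. g (y, x) \<partial>K y) \<and> (\<integral>x. g (y, x) \<partial>K y) \<le> C"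
      using b by (auto intro!: integral_nonneg_AE integral_le_const i)
  qed
  have "(\<lambda>y. \<integral>x. g (y, x) \<partial>K y) \<in> borel_measurable X"
  proof (subst measurable_cong)
    show "(\<integral>x. g (y, x) \<partial>K y) = enn2real (\<integral>\<^sup>+x. ennreal (g (y, x)) \<partial>K y)" if "y \<in> space X" for y
      using inner[OF that, symmetric] inner_bound[OF that] by simp
    have "(\<lambda>y. \<integral>\<^sup>+x. ennreal (g (y, x)) \<partial>K y) \<in> borel_measurable X"
      by (rule nn_integral_measurable_subprob_algebra2[OF _ measurable_prob_algebraD[OF K]]) measurable
    then show "(\<lambda>y. enn2real (\<integral>\<^sup>+x. ennreal (g (y, x)) \<partial>K y)) \<in> borel_measurable X" by measurable
  qed
  then have "(\<lambda>y. \<integral>x. g (y, x) \<partial>K y) \<in> borel_measurable q"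
    using q' by (simp cong: measurable_cong_sets)
  then show iq: "integrable q (\<lambda>y. \<integral>x. g (y, x) \<partial>K y)"
    using inner_bound spq by (intro q.integrable_const_bound[where B=C]) auto
  have "ennreal (\<integral>y. \<integral>x. g (y, x) \<partial>K y \<partial>q) = (\<integral>\<^sup>+y. ennreal (\<integral>x. g (y, x) \<partial>K y) \<partial>q)"
    using inner_bound spq by (intro nn_integral_eq_integral[symmetric] iq) auto
  also have "\<dots> = (\<integral>\<^sup>+y. \<integral>\<^sup>+x. ennreal (g (y, x)) \<partial>K y \<partial>q)"
    using inner spq by (intro nn_integral_cong) auto
  also have "\<dots> = (\<integral>\<^sup>+z. ennreal (g z) \<partial>joint_law X q K)"
    by (rule nn_integral_joint_law[OF q K, symmetric]) measurable
  also have "\<dots> = ennreal (\<integral>z. g z \<partial>joint_law X q K)"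
    using bounded spQ by (intro nn_integral_eq_integral Q.integrable_const_bound[where B=C]) auto
  finally show "(\<integral>y. \<integral>x. g (y, x) \<partial>K y \<partial>q) = (\<integral>z. g z \<partial>joint_law X q K)"
  proof (subst (asm) ennreal_inj)
    show "0 \<le> (\<integral>y. \<integral>x. g (y, x) \<partial>K y \<partial>q)"
      by (rule Bochner_Integration.integral_nonneg) (use inner_bound spq in simp)
    show "0 \<le> (\<integral>z. g z \<partial>joint_law X q K)"
      using bounded spQ by (intro Bochner_Integration.integral_nonneg) auto
  qed
qed


section \<open>From the conditional bound to the theorem\<close>

text \<open>A learned baseline is only known to dominate the one with the population threshold. The
  clipping error decreases in the baseline, so it may be estimated at the lower value
  \<open>\<beta>\<^sub>0\<close>.\<close>

lemma tv_dist_baseline_step_chernoff: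
  assumes p: "prob_space p" and f[measurable]: "f \<in> borel_measurable p"
    and B: "\<And>x. x \<in> space p \<Longrightarrow> f x \<in> {-B..B}" and \<beta>: "\<beta>\<^sub>0 \<le> \<beta>" and l: "1 \<le> l"
  shows "tv_dist (baseline_step p f \<beta>) (reweight p (\<lambda>x. exp (f x)))
    \<le> (\<integral>x. exp k * exp (l * (f x - \<beta>\<^sub>0)) + exp (- l * (k + (f x - \<beta>\<^sub>0))) \<partial>p)"
proof -
  interpret prob_space p by fact
  have int: "integrable p (\<lambda>x. exp (f x))"
    by (rule integrable_exp_bounded[where C=B]) (use B in auto)
  have W: "0 < (\<integral>x. exp (f x) \<partial>p)" by (rule integral_pos[OF int]) simp
  have int_excess: "integrable p (\<lambda>x. max 0 (exp (f x) - exp b))" for b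
    by (rule Bochner_Integration.integrable_bound[OF int]) auto
  have "tv_dist (baseline_step p f \<beta>) (reweight p (\<lambda>x. exp (f x)))
      \<le> (\<integral>x. max 0 (exp (f x) - exp \<beta>) \<partial>p) / (\<integral>x. exp (f x) \<partial>p)"
    by (rule tv_dist_baseline_step[OF p f int])
  also have "\<dots> \<le> (\<integral>x. max 0 (exp (f x) - exp \<beta>\<^sub>0) \<partial>p) / (\<integral>x. exp (f x) \<partial>p)"
    using W
  proof (intro divide_right_mono integral_mono int_excess)
    show "max 0 (exp (f x) - exp \<beta>) \<le> max 0 (exp (f x) - exp \<beta>\<^sub>0)" for x
      using \<beta> by (intro max.mono) auto
  qed auto
  \<comment> \<open>Extracting \<open>exp \<beta>\<^sub>0\<close> above and below moves the cut to
    1, the form that \<open>clipped_excess_le\<close> treats with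
    \<open>s x = f x - \<beta>\<^sub>0\<close>.\<close>
  also have "\<dots> = (\<integral>x. exp \<beta>\<^sub>0 * max 0 (exp (f x - \<beta>\<^sub>0) - 1) \<partial>p)
      / (\<integral>x. exp \<beta>\<^sub>0 * exp (f x - \<beta>\<^sub>0) \<partial>p)"
  proof -
    have "max 0 (exp (f x) - exp \<beta>\<^sub>0) = exp \<beta>\<^sub>0 * max 0 (exp (f x - \<beta>\<^sub>0) - 1)"
      "exp (f x) = exp \<beta>\<^sub>0 * exp (f x - \<beta>\<^sub>0)" for x
      by (auto simp: max_def exp_diff field_simps)
    then show ?thesis by simp
  qed
  also have "\<dots> = (\<integral>x. max 0 (exp (f x - \<beta>\<^sub>0) - 1) \<partial>p) / (\<integral>x. exp (f x - \<beta>\<^sub>0) \<partial>p)"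
    by simp
  also have "\<dots> \<le> (\<integral>x. exp k * exp (l * (f x - \<beta>\<^sub>0)) + exp (- l * (k + (f x - \<beta>\<^sub>0))) \<partial>p)"
  proof (rule clipped_excess_le[OF _ _ l])
    show "\<bar>f x - \<beta>\<^sub>0\<bar> \<le> B + \<bar>\<beta>\<^sub>0\<bar>" if "x \<in> space p" for x
      using B[OF that] by auto
  qed simp
  finally show ?thesis .
qed

text \<open>Binding with a Markov kernel preserves probability measures on \<open>X\<close>. The
  first \<open>k\<close> steps read the baselines of times \<open>T\<close> down to
  \<open>T - k + 1\<close>, hence the range \<open>j < k\<close>.\<close>

lemma sampler_after_in_prob_algebra:
  assumes pre_init: "pre_init \<in> space (prob_algebra X)"
    and pre: "\<And>s. s < T \<Longrightarrow> pre s \<in> X \<rightarrow>\<^sub>M prob_algebra X"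
    and v: "\<And>s. s \<le> T \<Longrightarrow> v s \<in> borel_measurable X"
    and base: "\<And>j. j < k \<Longrightarrow> base (T - j) \<in> borel_measurable X"
    and k: "k \<le> T"
  shows "sampler_after T pre_init pre v base_init base k \<in> space (prob_algebra X)"
  using base k
proof (induction k)
  case 0
  have "(\<lambda>p. baseline_step p (v T) base_init) \<in> prob_algebra X \<rightarrow>\<^sub>M prob_algebra X"
    using v by (intro measurable_baseline_step) auto
  from measurable_space[OF this pre_init] show ?case by simp
next
  case (Suc k)
  have IH: "sampler_after T pre_init pre v base_init base k \<in> space (prob_algebra X)"
    using Suc by simp
  have step: "(\<lambda>y. baseline_step (pre (T - Suc k) y) (v (T - Suc k)) (base (T - k) y))
      \<in> X \<rightarrow>\<^sub>M prob_algebra X"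
    using Suc.prems by (intro measurable_baseline_step pre v) auto
  show ?case
    using measurable_space[OF measurable_bind_prob_space[OF measurable_ident step] IH] by simp
qed

text \<open>Write \<open>u\<close> and \<open>w\<close> for the two exponential moments in the
  objective. The threshold satisfies \<open>exp (l * \<tau>) = u / \<delta>\<close> and the
  objective \<open>exp (l * k) = u * w / \<delta>\<^sup>2\<close>, so averaging the conditional
  bound with this \<open>k\<close> gives \<open>\<delta> * exp k\<close> from the upper tail and
  \<open>\<delta>\<close> from the lower tail.\<close>

lemma expected_tv_dist_baseline_step_le:
  fixes X q :: "'a measure" and K :: "'a \<Rightarrow> 'a measure" and f b \<beta> :: "'a \<Rightarrow> real"
  defines "E \<equiv> integral\<^sup>L (joint_law X q K)"
  assumes q: "q \<in> space (prob_algebra X)" and K[measurable]: "K \<in> X \<rightarrow>\<^sub>M prob_algebra X"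
    and f[measurable]: "f \<in> borel_measurable X" and fB: "\<And>x. x \<in> space X \<Longrightarrow> f x \<in> {-B..B}"
    and b[measurable]: "b \<in> borel_measurable X" and bB: "\<And>x. x \<in> space X \<Longrightarrow> b x \<in> {-B..B}"
    and \<delta>: "0 < \<delta>" "\<delta> \<le> 1" and l: "1 \<le> l"
    and \<beta>: "\<And>y. y \<in> space X \<Longrightarrow> b y + chernoff_threshold E f \<delta> l b \<le> \<beta> y"
  shows "(\<integral>y. tv_dist (baseline_step (K y) f (\<beta> y)) (reweight (K y) (\<lambda>x. exp (f x))) \<partial>q)
    \<le> 2 * \<delta> * exp (chernoff_objective E f \<delta> l b)"
proof -
  define Q where "Q = joint_law X q K"
  have sets_Q[measurable_cong]: "sets Q = sets (X \<Otimes>\<^sub>M X)"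
    unfolding Q_def by (rule sets_joint_law[OF q K])
  have space_Q: "space Q = space X \<times> space X"
    using sets_eq_imp_space_eq[OF sets_Q] by (simp add: space_pair_measure)
  interpret Q: prob_space Q unfolding Q_def by (rule prob_space_joint_law[OF q K])
  define d where "d z = l * (f (snd z) - b (fst z))" for z
  have [measurable]: "d \<in> borel_measurable (X \<Otimes>\<^sub>M X)" unfolding d_def by measurable
  have d_bound: "\<bar>d z\<bar> \<le> l * (2 * B)" if "z \<in> space Q" for z
  proof -
    have "\<bar>f (snd z) - b (fst z)\<bar> \<le> 2 * B"
      using that fB[of "snd z"] bB[of "fst z"] by (auto simp: space_Q)
    then show ?thesis using l by (simp add: d_def abs_mult)
  qed
  have d_int: "integrable Q d" and exp_int: "integrable Q (\<lambda>z. exp (d z))" "integrable Q (\<lambda>z. exp (- d z))"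
    using d_bound by (auto simp: abs_le_iff intro!: Q.integrable_const_bound[where B="l * (2 * B)"]
        Q.integrable_exp_bounded[where C="l * (2 * B)"])
  define u w where "u = (\<integral>z. exp (d z) \<partial>Q)" and "w = (\<integral>z. exp (- d z) \<partial>Q)"
  have pos: "0 < u" "0 < w"
    unfolding u_def w_def by (auto intro!: Q.integral_pos exp_int)
  have uw: "1 \<le> u * w"
    unfolding u_def w_def by (rule Q.integral_exp_mult_integral_exp_minus[OF d_int exp_int])
  \<comment> \<open>The free parameter of the conditional bound is set to the value of the objective
    itself.\<close>
  define k where "k = chernoff_objective E f \<delta> l b"
  define \<tau> where "\<tau> = chernoff_threshold E f \<delta> l b"
  have E: "E (\<lambda>(y, x). exp (l * (f x - b y))) = u" "E (\<lambda>(y, x). exp (l * (b y - f x))) = w"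
    unfolding E_def u_def w_def d_def Q_def[symmetric]
    by (auto intro!: Bochner_Integration.integral_cong simp: algebra_simps)
  have "l * \<tau> = ln (u / \<delta>)"
    using l pos \<delta> by (simp add: \<tau>_def chernoff_threshold_def E ln_div)
  then have exp_\<tau>: "exp (l * \<tau>) = u / \<delta>" using pos \<delta> by simp
  have "l * k = ln u + ln w + 2 * ln (1 / \<delta>)"
    unfolding k_def chernoff_objective_def E using l by (simp add: distrib_left)
  also have "\<dots> = ln (u * w / \<delta>\<^sup>2)"
    using pos \<delta> by (simp add: ln_div ln_mult ln_realpow)
  finally have "l * k = ln (u * w / \<delta>\<^sup>2)" .
  then have exp_k: "exp (l * k) = u * w / \<delta>\<^sup>2" and lk: "l * k = ln (u * w / \<delta>\<^sup>2)"
    using pos \<delta> by simp_all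
  \<comment> \<open>Since \<open>1 \<le> u * w\<close> and \<open>\<delta> \<le> 1\<close>, the
    logarithm equal to \<open>l * k\<close> is nonnegative; \<open>0 \<le> k\<close> later absorbs
    the summand 1 into \<open>exp k\<close>.\<close>
  have "\<delta>\<^sup>2 \<le> u * w" using uw \<delta> power_le_one[of \<delta> 2] by linarith
  then have "0 \<le> l * k" unfolding lk using \<delta> by simp
  then have k: "0 \<le> k" using l by (simp add: zero_le_mult_iff)
  \<comment> \<open>This is the conditional bound at \<open>\<beta>\<^sub>0 = b y + \<tau>\<close>,
    written through the exponent \<open>d\<close> so that it becomes a function on pairs of
    states.\<close>
  define g where "g z = exp k * exp (d z - l * \<tau>) + exp (- d z + l * \<tau> - l * k)" for z
  have [measurable]: "g \<in> borel_measurable (X \<Otimes>\<^sub>M X)" unfolding g_def by measurable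
  define C where "C = exp k * exp (l * (2 * B) - l * \<tau>) + exp (l * (2 * B) + l * \<tau> - l * k)"
  have g_bound: "0 \<le> g z \<and> g z \<le> C" if "z \<in> space (X \<Otimes>\<^sub>M X)" for z
    using d_bound[of z] that sets_eq_imp_space_eq[OF sets_Q]
    by (auto simp: g_def C_def abs_le_iff intro!: add_mono)
  note gQ = integral_joint_law[OF q K _ g_bound, folded Q_def]
  have "(\<integral>y. tv_dist (baseline_step (K y) f (\<beta> y)) (reweight (K y) (\<lambda>x. exp (f x))) \<partial>q)
      \<le> (\<integral>y. \<integral>x. g (y, x) \<partial>K y \<partial>q)"
  \<comment> \<open>\<open>integral_mono'\<close> spares the measurability of the total variation distance: a non-integrable
      left-hand side integrates to 0.\<close>
  proof (rule integral_mono')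
    show "integrable q (\<lambda>y. \<integral>x. g (y, x) \<partial>K y)" by (rule gQ) measurable
    fix y assume "y \<in> space q"
    then have y: "y \<in> space X"
      using q sets_eq_imp_space_eq[of q X] by (simp add: space_prob_algebra)
    have K': "sets (K y) = sets X" "prob_space (K y)"
      using measurable_space[OF K y] by (auto simp: space_prob_algebra)
    show "0 \<le> (\<integral>x. g (y, x) \<partial>K y)" by (auto simp: g_def intro!: Bochner_Integration.integral_nonneg)
    have "tv_dist (baseline_step (K y) f (\<beta> y)) (reweight (K y) (\<lambda>x. exp (f x)))
        \<le> (\<integral>x. exp k * exp (l * (f x - (b y + \<tau>))) + exp (- l * (k + (f x - (b y + \<tau>)))) \<partial>K y)"
      using K'(1) f fB sets_eq_imp_space_eq[OF K'(1)] \<beta>[OF y] l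
      by (intro tv_dist_baseline_step_chernoff[where B=B] K')
         (auto simp: \<tau>_def cong: measurable_cong_sets)
    also have "\<dots> = (\<integral>x. g (y, x) \<partial>K y)"
      by (simp add: g_def d_def algebra_simps)
    finally show "tv_dist (baseline_step (K y) f (\<beta> y)) (reweight (K y) (\<lambda>x. exp (f x)))
        \<le> (\<integral>x. g (y, x) \<partial>K y)" .
  qed
  also have "\<dots> = (\<integral>z. g z \<partial>Q)" by (rule gQ) measurable
  also have "\<dots> = (\<integral>z. exp k / exp (l * \<tau>) * exp (d z) + exp (l * \<tau>) / exp (l * k) * exp (- d z) \<partial>Q)"
    by (simp add: g_def exp_diff exp_add exp_minus field_simps)
  also have "\<dots> = exp k / exp (l * \<tau>) * u + exp (l * \<tau>) / exp (l * k) * w"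
    using exp_int by (simp add: u_def w_def)
  \<comment> \<open>In the first term \<open>u\<close> cancels against
    \<open>exp (l * \<tau>)\<close>; in the second, \<open>(u / \<delta>) * w\<close> cancels
    against \<open>u * w / \<delta>\<^sup>2\<close>. One factor \<open>\<delta>\<close> survives in
    each.\<close>
  also have "\<dots> = \<delta> * (exp k + 1)"
    unfolding exp_\<tau> exp_k using pos \<delta> by (simp add: field_simps power2_eq_square)
  also have "\<dots> \<le> \<delta> * (2 * exp k)"
    using k \<delta> by (intro mult_left_mono) auto
  finally show ?thesis by (simp add: k_def)
qed

text \<open>The argument is pathwise: once the sample \<open>\<omega>\<close> is fixed,
  \<open>lhat \<omega>\<close> and \<open>bhat \<omega>\<close> are admissible deterministic
  parameters, and the averaged one-step bound applies to them.\<close>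

theorem theorem4p6:
  fixes X :: "'a measure" and T t m :: nat
    and pre_init :: "'a measure" and pre :: "nat \<Rightarrow> 'a \<Rightarrow> 'a measure"
    and v base :: "nat \<Rightarrow> 'a \<Rightarrow> real" and base_init B :: real
    and H :: "('a \<Rightarrow> real) set" and \<delta> \<Lambda> \<eta> c :: real
    and q :: "'a measure" and Q :: "('a \<times> 'a) measure"
    and J :: "real \<Rightarrow> ('a \<Rightarrow> real) \<Rightarrow> real" and \<tau> :: "real \<Rightarrow> ('a \<Rightarrow> real) \<Rightarrow> real"
    and Jhat :: "(nat \<Rightarrow> 'a \<times> 'a) \<Rightarrow> real \<Rightarrow> ('a \<Rightarrow> real) \<Rightarrow> real"
    and \<tau>hat :: "(nat \<Rightarrow> 'a \<times> 'a) \<Rightarrow> real \<Rightarrow> ('a \<Rightarrow> real) \<Rightarrow> real"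
    and Jstar :: real and \<epsilon>\<^sub>0 :: "(nat \<Rightarrow> 'a \<times> 'a) \<Rightarrow> real"
    and lhat :: "(nat \<Rightarrow> 'a \<times> 'a) \<Rightarrow> real" and bhat :: "(nat \<Rightarrow> 'a \<times> 'a) \<Rightarrow> 'a \<Rightarrow> real"
    and good :: "(nat \<Rightarrow> 'a \<times> 'a) set" and \<omega> :: "nat \<Rightarrow> 'a \<times> 'a"
    and Bhat :: "'a \<Rightarrow> real"
  assumes pre_init: "pre_init \<in> space (prob_algebra X)"
    and pre: "\<And>s. s < T \<Longrightarrow> pre s \<in> X \<rightarrow>\<^sub>M prob_algebra X"
    and v_measurable: "\<And>s. s \<le> T \<Longrightarrow> v s \<in> borel_measurable X"
    and v_bounded: "\<And>s x. s \<le> T \<Longrightarrow> x \<in> space X \<Longrightarrow> v s x \<in> {-B..B}"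
    and t: "t < T"
    and base_measurable: "\<And>s. t + 2 \<le> s \<Longrightarrow> s \<le> T \<Longrightarrow> base s \<in> borel_measurable X"
    and H_measurable: "\<And>b. b \<in> H \<Longrightarrow> b \<in> borel_measurable X"
    and H_bounded: "\<And>b x. b \<in> H \<Longrightarrow> x \<in> space X \<Longrightarrow> b x \<in> {-B..B}"
    and \<delta>: "0 < \<delta>" "\<delta> < 1" and \<Lambda>: "2 < \<Lambda>" and \<eta>: "0 < \<eta>" "\<eta> < 1"
    and c: "0 < c" "c < 1" and m: "0 < m"
  defines "q \<equiv> sampler_marginal T pre_init pre v base_init base (t + 1)"
    and "Q \<equiv> joint_law X q (pre t)"
    and "J \<equiv> chernoff_objective (integral\<^sup>L Q) (v t) \<delta>"
    and "\<tau> \<equiv> chernoff_threshold (integral\<^sup>L Q) (v t) \<delta>"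
    and "Jhat \<equiv> \<lambda>\<omega>. chernoff_objective (empirical_mean m \<omega>) (v t) \<delta>"
    and "\<tau>hat \<equiv> \<lambda>\<omega>. chernoff_threshold (empirical_mean m \<omega>) (v t) \<delta>"
    and "Jstar \<equiv> (INF (l, b)\<in>{2<..<\<Lambda>} \<times> H. J l b)"
    and "\<epsilon>\<^sub>0 \<equiv> \<lambda>\<omega>. exp (4 * B * \<Lambda>) *
           (2 * empirical_rademacher m H (\<lambda>i. fst (\<omega> i)) + sqrt (ln (1 / \<eta>) / (2 * real m)))"
    and "good \<equiv> {\<omega> \<in> space (\<Pi>\<^sub>M i\<in>{..<m}. Q).
           J (lhat \<omega>) (bhat \<omega>) - Jstar \<le> 2 * \<epsilon>\<^sub>0 \<omega> \<and>
           \<bar>\<tau>hat \<omega> (lhat \<omega>) (bhat \<omega>) - \<tau> (lhat \<omega>) (bhat \<omega>)\<bar> \<le> \<epsilon>\<^sub>0 \<omega>}"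
    and "Bhat \<equiv> \<lambda>y. bhat \<omega> y + \<tau>hat \<omega> (lhat \<omega>) (bhat \<omega>) + \<epsilon>\<^sub>0 \<omega>"
  assumes Jstar_attained:
      "\<exists>p. is_arg_min (\<lambda>(l, b). J l b) (\<lambda>p. p \<in> {2<..<\<Lambda>} \<times> H) p"
    and empirical_minimizer:
      "is_arg_min (\<lambda>(l, b). Jhat \<omega> l b) (\<lambda>p. p \<in> {2<..<\<Lambda>} \<times> H) (lhat \<omega>, bhat \<omega>)"
    and coverage:
      "\<And>y. y \<in> space X \<Longrightarrow> measure (pre t y) {x \<in> space X. v t x \<ge> Bhat y} \<le> c"
    and good_event: "\<omega> \<in> good"
  shows "(\<integral>y. tv_dist (baseline_step (pre t y) (v t) (Bhat y))
                     (reweight (pre t y) (\<lambda>x. exp (v t x))) \<partial>q)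
         \<le> 2 * \<delta> / (1 - c)\<^sup>2 * exp (Jstar + 2 * \<epsilon>\<^sub>0 \<omega>)"
proof -
  \<comment> \<open>Reaching time \<open>t + 1\<close> takes \<open>T - (t + 1)\<close> steps, which
    read exactly the baselines of times \<open>t + 2\<close> to \<open>T\<close>.\<close>
  have q: "q \<in> space (prob_algebra X)"
    unfolding q_def sampler_marginal_def
    using t by (intro sampler_after_in_prob_algebra pre_init pre v_measurable base_measurable) auto
  have l: "2 < lhat \<omega>" and bH: "bhat \<omega> \<in> H"
    using empirical_minimizer by (auto simp: is_arg_min_def)
  \<comment> \<open>The two halves of the good event have separate uses: the first compares the
    objective with its minimum, the second puts \<open>Bhat\<close> above
    \<open>bhat \<omega>\<close> plus the population threshold.\<close>
  have J_le: "J (lhat \<omega>) (bhat \<omega>) \<le> Jstar + 2 * \<epsilon>\<^sub>0 \<omega>"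
    and \<tau>_le: "\<tau> (lhat \<omega>) (bhat \<omega>) \<le> \<tau>hat \<omega> (lhat \<omega>) (bhat \<omega>) + \<epsilon>\<^sub>0 \<omega>"
    using good_event by (auto simp: good_def)
  have "(\<integral>y. tv_dist (baseline_step (pre t y) (v t) (Bhat y))
                     (reweight (pre t y) (\<lambda>x. exp (v t x))) \<partial>q)
      \<le> 2 * \<delta> * exp (J (lhat \<omega>) (bhat \<omega>))"
    unfolding J_def Q_def
  proof (rule expected_tv_dist_baseline_step_le[OF q pre[OF t], where B=B])
    show "bhat \<omega> y + chernoff_threshold (integral\<^sup>L (joint_law X q (pre t))) (v t) \<delta> (lhat \<omega>) (bhat \<omega>)
        \<le> Bhat y" for y
      using \<tau>_le by (simp add: Bhat_def \<tau>_def Q_def)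
  qed (use t l \<delta> v_measurable v_bounded H_measurable[OF bH] H_bounded[OF bH] in auto)
  also have "\<dots> \<le> 2 * \<delta> * exp (Jstar + 2 * \<epsilon>\<^sub>0 \<omega>)"
    using J_le \<delta> by simp
  \<comment> \<open>Division by \<open>(1 - c)\<^sup>2\<close>, a number in (0, 1], can only enlarge
    the bound.\<close>
  also have "\<dots> \<le> 2 * \<delta> / (1 - c)\<^sup>2 * exp (Jstar + 2 * \<epsilon>\<^sub>0 \<omega>)"
  proof -
    have "0 < (1 - c)\<^sup>2" "(1 - c)\<^sup>2 \<le> 1" using c by (auto intro: power_le_one)
    then have "2 * \<delta> \<le> 2 * \<delta> / (1 - c)\<^sup>2" using \<delta> by (simp add: le_divide_eq_1 field_simps)
    then show ?thesis by (intro mult_right_mono) auto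
  qed
  finally show ?thesis .
qed

end
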